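(* Let $(\Omega,\mathcal A,P)$ be a probability space, let $f\colon[0,1]\times\Omega\to[0,1]$ satisfy $f(0,\omega)=0$ and $f(1,\omega)=1$ for every $\omega\in\Omega$, let $a,b\in\mathbb R$, and let $\mathcal B([0,1],\mathbb R)$ be a linear subspace of $\mathcal M([0,1],\mathbb R)$ with $T(\mathcal B([0,1],\mathbb R))\subset\mathcal B([0,1],\mathbb R)$. Let $\mathfrak{sol}_a^b(E_0)$ denote the set of all $\Phi\in\mathcal B_a^b$ such that $\Phi(x)=\int_\Omega\Phi(f(x,\omega))\,dP(\omega)$ for every $x\in[0,1]$. Then for every medial limit $B\in\mathfrak M$ we have $$\mathfrak{sol}_a^b(E_0)\subset\{B_h:h\in\mathcal B_a^b\}.$$ Moreover, if $\mathcal B_a^b$ is closed under $B\in\mathfrak M$, then $$\mathfrak{sol}_a^b(E_0)=\{B_h:h\in\mathcal B_a^b\}.$$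
   Context: $\mathbb N=\{1,2,\dots\}$. $B([0,1],\mathbb R)$ is the space of all bounded functions $[0,1]\to\mathbb R$ with the supremum norm. $\mathcal M([0,1],\mathbb R)$ is the space of all $h\in B([0,1],\mathbb R)$ such that $\omega\mapsto h(f(x,\omega))$ is measurable for every $x\in[0,1]$. The linear operator $T\colon\mathcal M([0,1],\mathbb R)\to B([0,1],\mathbb R)$ is $Th(x)=\int_\Omega h(f(x,\omega))\,dP(\omega)$. $\mathcal B_a^b$ is the set of all $h\in\mathcal B([0,1],\mathbb R)$ with $h(0)=a$ and $h(1)=b$. A Banach limit is a linear, positive, shift invariant, normalized functional $B\colon l^\infty(\mathbb N)\to\mathbb R$ on the space of bounded real sequences; $\mathfrak B$ is the set of all Banach limits. $\mathfrak M\subset\mathfrak B$ is the set of medial limits (with respect to $(\Omega,\mathcal A,P)$): $B\in\mathfrak M$ if for every (uniformly) bounded sequence $(h_m)_{m\in\mathbb N}$ of measurable real-valued functions on $\Omega$ the function $\omega\mapsto B((h_m(\omega))_{m\in\mathbb N})$ is measurable and $\int_\Omega B((h_m(\omega))_{m\in\mathbb N})\,dP(\omega)=B\big((\int_\Omega h_m(\omega)\,dP(\omega))_{m\in\mathbb N}\big)$. For $h\in\mathcal B([0,1],\mathbb R)$ and $B\in\mathfrak B$, the function $B_h\colon[0,1]\to\mathbb R$ is $B_h(x)=B\big((T^mh(x))_{m\in\mathbb N}\big)$. The class $\mathcal B_a^b$ is closed under $B\in\mathfrak B$ if $B_h\in\mathcal B_a^b$ for every $h\in\mathcal B_a^b$.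 *)

theory Defs
  imports "HOL-Probability.Probability"
begin

text \<open>
  A function on \<open>[0,1]\<close> is a function of type \<^typ>\<open>real \<Rightarrow> real\<close> in
  \<^term>\<open>extensional {0..1::real}\<close>, so that equality of such functions is equality on \<open>[0,1]\<close>.
\<close>

definition bounded_fns :: "(real \<Rightarrow> real) set" where
  "bounded_fns = {h \<in> extensional {0..1}. bounded (h ` {0..1})}"

definition measurable_fns :: "'w measure \<Rightarrow> (real \<Rightarrow> 'w \<Rightarrow> real) \<Rightarrow> (real \<Rightarrow> real) set" where
  "measurable_fns P f =
     {h \<in> bounded_fns. \<forall>x\<in>{0..1}. (\<lambda>\<omega>. h (f x \<omega>)) \<in> borel_measurable P}"

definition transfer_op ::
  "'w measure \<Rightarrow> (real \<Rightarrow> 'w \<Rightarrow> real) \<Rightarrow> (real \<Rightarrow> real) \<Rightarrow> (real \<Rightarrow> real)" where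
  "transfer_op P f h = (\<lambda>x\<in>{0..1}. \<integral>\<omega>. h (f x \<omega>) \<partial>P)"

text \<open>Linear subspaces, with respect to the pointwise operations on \<open>[0,1]\<close>.\<close>

definition linear_subspace_of :: "(real \<Rightarrow> real) set \<Rightarrow> (real \<Rightarrow> real) set \<Rightarrow> bool" where
  "linear_subspace_of S V \<longleftrightarrow>
     S \<subseteq> V \<and>
     (\<lambda>x\<in>{0..1}. 0) \<in> S \<and>
     (\<forall>g\<in>S. \<forall>h\<in>S. (\<lambda>x\<in>{0..1}. g x + h x) \<in> S) \<and>
     (\<forall>c. \<forall>h\<in>S. (\<lambda>x\<in>{0..1}. c * h x) \<in> S)"

definition with_boundary :: "(real \<Rightarrow> real) set \<Rightarrow> real \<Rightarrow> real \<Rightarrow> (real \<Rightarrow> real) set" where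
  "with_boundary S a b = {h \<in> S. h 0 = a \<and> h 1 = b}"

text \<open>
  A sequence \<open>(x\<^sub>m)\<close> indexed by \<open>m = 1, 2, \<dots>\<close> is represented by the function
  \<open>\<lambda>n. x\<^sub>n\<^sub>+\<^sub>1\<close> on \<^typ>\<open>nat\<close>.  Functionals on bounded sequences are total functions on
  \<^typ>\<open>nat \<Rightarrow> real\<close>; their values at unbounded sequences are arbitrary and never used.
\<close>

definition bounded_seqs :: "(nat \<Rightarrow> real) set" where
  "bounded_seqs = {x. bounded (range x)}"

definition banach_limits :: "((nat \<Rightarrow> real) \<Rightarrow> real) set" where
  "banach_limits = {B.
     (\<forall>x\<in>bounded_seqs. \<forall>y\<in>bounded_seqs. B (\<lambda>n. x n + y n) = B x + B y) \<and>
     (\<forall>c. \<forall>x\<in>bounded_seqs. B (\<lambda>n. c * x n) = c * B x) \<and>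
     (\<forall>x\<in>bounded_seqs. (\<forall>n. 0 \<le> x n) \<longrightarrow> 0 \<le> B x) \<and>
     (\<forall>x\<in>bounded_seqs. B (\<lambda>n. x (Suc n)) = B x) \<and>
     B (\<lambda>n. 1) = 1}"

definition medial_limits :: "'w measure \<Rightarrow> ((nat \<Rightarrow> real) \<Rightarrow> real) set" where
  "medial_limits P = {B \<in> banach_limits.
     \<forall>h :: nat \<Rightarrow> 'w \<Rightarrow> real.
       (\<forall>m. h m \<in> borel_measurable P) \<longrightarrow>
       (\<exists>C. \<forall>m. \<forall>\<omega>\<in>space P. \<bar>h m \<omega>\<bar> \<le> C) \<longrightarrow>
         (\<lambda>\<omega>. B (\<lambda>m. h m \<omega>)) \<in> borel_measurable P \<and>
         (\<integral>\<omega>. B (\<lambda>m. h m \<omega>) \<partial>P) = B (\<lambda>m. \<integral>\<omega>. h m \<omega> \<partial>P)}"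

text \<open>The function \<open>B\<^sub>h\<close>; the sequence of iterates starts with \<open>T\<^sup>1 h\<close>.\<close>

definition limit_fn ::
  "'w measure \<Rightarrow> (real \<Rightarrow> 'w \<Rightarrow> real) \<Rightarrow> ((nat \<Rightarrow> real) \<Rightarrow> real) \<Rightarrow> (real \<Rightarrow> real) \<Rightarrow> (real \<Rightarrow> real)" where
  "limit_fn P f B h = (\<lambda>x\<in>{0..1}. B (\<lambda>n. (transfer_op P f ^^ Suc n) h x))"

definition closed_under ::
  "'w measure \<Rightarrow> (real \<Rightarrow> 'w \<Rightarrow> real) \<Rightarrow> (real \<Rightarrow> real) set \<Rightarrow> ((nat \<Rightarrow> real) \<Rightarrow> real) \<Rightarrow> bool" where
  "closed_under P f H B \<longleftrightarrow> (\<forall>h\<in>H. limit_fn P f B h \<in> H)"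

definition sol_E0 ::
  "'w measure \<Rightarrow> (real \<Rightarrow> 'w \<Rightarrow> real) \<Rightarrow> (real \<Rightarrow> real) set \<Rightarrow> real \<Rightarrow> real \<Rightarrow> (real \<Rightarrow> real) set" where
  "sol_E0 P f S a b =
     {\<Phi> \<in> with_boundary S a b. \<forall>x\<in>{0..1}. \<Phi> x = (\<integral>\<omega>. \<Phi> (f x \<omega>) \<partial>P)}"

end

theory Submission imports Defs begin

text \<open>
  Write \<open>T\<close> for the operator \<^const>\<open>transfer_op\<close>. A function satisfies \<open>(E\<^sub>0)\<close> exactly when it is
  a fixed point of \<open>T\<close>.

  A fixed point \<open>\<Phi>\<close> has constant iterates, and a Banach limit maps a constant sequence to its
  value, so \<open>B\<^sub>\<Phi> = \<Phi>\<close>; this gives the inclusion, with \<open>\<Phi>\<close> as its own preimage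
  (\<open>limit_fn_fixed_point\<close>). Conversely, every \<open>B\<^sub>h\<close> solves the equation (\<open>limit_fn_solves\<close>):
  a medial limit commutes with the integral, hence
  \<open>T B\<^sub>h(x) = B((\<integral> T\<^sup>m h(f(x,\<omega>)) dP)\<^sub>m) = B((T\<^sup>m\<^sup>+\<^sup>1 h(x))\<^sub>m)\<close>,
  and shift invariance turns the right-hand side back into \<open>B\<^sub>h(x)\<close>. The interchange needs a bound
  on the iterates that is uniform in \<open>m\<close>; since \<open>P\<close> is a probability, \<open>T\<close> does not increase the
  supremum norm, and a bound for \<open>h\<close> serves them all. The closedness hypothesis then only has to
  put \<open>B\<^sub>h\<close> into the right function class.
\<close>

lemma banach_limit_const:
  assumes "B \<in> banach_limits"
  shows "B (\<lambda>n. c) = c"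
proof -
  have scale: "\<forall>c. \<forall>x\<in>bounded_seqs. B (\<lambda>n. c * x n) = c * B x" and one: "B (\<lambda>n. 1) = 1"
    using assms unfolding banach_limits_def mem_Collect_eq by - (elim conjE, assumption)+
  have "(\<lambda>n::nat. 1::real) \<in> bounded_seqs"
    by (simp add: bounded_seqs_def)
  then have "B (\<lambda>n. c * 1) = c * B (\<lambda>n. 1)"
    by (rule bspec[OF spec[OF scale]])
  then show ?thesis
    by (simp add: one)
qed

lemma transfer_op_abs_le:
  assumes "prob_space P"
    and maps: "\<And>x \<omega>. x \<in> {0..1} \<Longrightarrow> \<omega> \<in> space P \<Longrightarrow> f x \<omega> \<in> {0..1}"
    and h: "h \<in> measurable_fns P f"
    and bound: "\<And>y. y \<in> {0..1} \<Longrightarrow> \<bar>h y\<bar> \<le> C"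
    and x: "x \<in> {0..1}"
  shows "\<bar>transfer_op P f h x\<bar> \<le> C"
proof -
  interpret prob_space P by fact
  have meas: "(\<lambda>\<omega>. h (f x \<omega>)) \<in> borel_measurable P"
    using h x by (simp add: measurable_fns_def)
  have le: "\<And>\<omega>. \<omega> \<in> space P \<Longrightarrow> \<bar>h (f x \<omega>)\<bar> \<le> C"
    using maps[OF x] bound by blast
  have int: "integrable P (\<lambda>\<omega>. h (f x \<omega>))"
    by (rule integrable_const_bound[where B = C]) (use le meas in auto)
  have "\<bar>\<integral>\<omega>. h (f x \<omega>) \<partial>P\<bar> \<le> (\<integral>\<omega>. \<bar>h (f x \<omega>)\<bar> \<partial>P)"
    by (rule integral_abs_bound)
  also have "\<dots> \<le> C"
    by (rule integral_le_const) (use int le in auto)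
  finally show ?thesis
    using x by (simp add: transfer_op_def)
qed

lemma transfer_op_iterate_mem:
  assumes "transfer_op P f ` S \<subseteq> S" and "h \<in> S"
  shows "(transfer_op P f ^^ n) h \<in> S"
  using assms by (induction n) auto

lemma transfer_op_iterate_abs_le:
  assumes prob: "prob_space P"
    and maps: "\<And>x \<omega>. x \<in> {0..1} \<Longrightarrow> \<omega> \<in> space P \<Longrightarrow> f x \<omega> \<in> {0..1}"
    and sub: "S \<subseteq> measurable_fns P f"
    and inv: "transfer_op P f ` S \<subseteq> S"
    and h: "h \<in> S"
    and bound: "\<And>y. y \<in> {0..1} \<Longrightarrow> \<bar>h y\<bar> \<le> C"
    and "x \<in> {0..1}"
  shows "\<bar>(transfer_op P f ^^ n) h x\<bar> \<le> C"
  using \<open>x \<in> {0..1}\<close>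
proof (induction n arbitrary: x)
  case 0
  then show ?case using bound by simp
next
  case (Suc n)
  have "(transfer_op P f ^^ n) h \<in> measurable_fns P f"
    using transfer_op_iterate_mem[OF inv h] sub by blast
  from transfer_op_abs_le[OF prob maps this Suc.IH Suc.prems] show ?case
    by simp
qed

lemma sol_E0_iff_fixed_point:
  assumes "S \<subseteq> measurable_fns P f"
  shows "\<Phi> \<in> sol_E0 P f S a b \<longleftrightarrow> \<Phi> \<in> with_boundary S a b \<and> transfer_op P f \<Phi> = \<Phi>"
proof -
  have "(\<forall>x\<in>{0..1}. \<Phi> x = (\<integral>\<omega>. \<Phi> (f x \<omega>) \<partial>P)) \<longleftrightarrow> transfer_op P f \<Phi> = \<Phi>"
    if "\<Phi> \<in> with_boundary S a b"
  proof -
    have "\<Phi> \<in> extensional {0..1}"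
      using that assms by (auto simp: with_boundary_def measurable_fns_def bounded_fns_def)
    then show ?thesis
      by (auto simp: transfer_op_def fun_eq_iff extensional_def)
  qed
  then show ?thesis
    unfolding sol_E0_def by blast
qed

lemma limit_fn_fixed_point:
  assumes B: "B \<in> banach_limits"
    and ext: "\<Phi> \<in> extensional {0..1}"
    and fixed_point: "transfer_op P f \<Phi> = \<Phi>"
  shows "limit_fn P f B \<Phi> = \<Phi>"
proof -
  have "(transfer_op P f ^^ n) \<Phi> = \<Phi>" for n
    by (induction n) (simp_all add: fixed_point)
  then have "limit_fn P f B \<Phi> = restrict \<Phi> {0..1}"
    unfolding limit_fn_def by (simp only: banach_limit_const[OF B])
  then show ?thesis
    using ext by (simp add: extensional_restrict)
qed

text \<open>
  The one place where \<open>B\<close> has to be medial rather than an arbitrary Banach limit: \<open>B\<close> is moved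
  out of the integral, and the integral then advances each iterate of \<open>T\<close> by one step, which shift
  invariance absorbs.
\<close>

lemma limit_fn_solves:
  assumes prob: "prob_space P"
    and maps: "\<And>x \<omega>. x \<in> {0..1} \<Longrightarrow> \<omega> \<in> space P \<Longrightarrow> f x \<omega> \<in> {0..1}"
    and sub: "S \<subseteq> measurable_fns P f"
    and inv: "transfer_op P f ` S \<subseteq> S"
    and B: "B \<in> medial_limits P"
    and h: "h \<in> S"
    and x: "x \<in> {0..1}"
  shows "limit_fn P f B h x = (\<integral>\<omega>. limit_fn P f B h (f x \<omega>) \<partial>P)"
proof -
  define u where "u n = (transfer_op P f ^^ Suc n) h" for n
  have meas: "(\<lambda>\<omega>. u n (f x \<omega>)) \<in> borel_measurable P" for n
    using transfer_op_iterate_mem[OF inv h, of "Suc n"] sub x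
    by (auto simp: u_def measurable_fns_def)
  have "bounded (h ` {0..1})"
    using h sub by (auto simp: measurable_fns_def bounded_fns_def)
  then obtain C where "\<forall>y\<in>{0..1}. \<bar>h y\<bar> \<le> C"
    unfolding bounded_iff by auto
  then have le: "\<bar>u n y\<bar> \<le> C" if "y \<in> {0..1}" for n y
    unfolding u_def using transfer_op_iterate_abs_le[OF prob maps sub inv h _ that] by blast
  have step: "(\<integral>\<omega>. u n (f x \<omega>) \<partial>P) = u (Suc n) x" for n
    using x by (simp add: u_def transfer_op_def)

  have "(\<integral>\<omega>. limit_fn P f B h (f x \<omega>) \<partial>P) = (\<integral>\<omega>. B (\<lambda>n. u n (f x \<omega>)) \<partial>P)"
    by (rule Bochner_Integration.integral_cong)
       (use maps[OF x] in \<open>simp_all add: limit_fn_def u_def\<close>)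
  also have "\<dots> = B (\<lambda>n. \<integral>\<omega>. u n (f x \<omega>) \<partial>P)"
  proof -
    have "\<exists>C. \<forall>n. \<forall>\<omega>\<in>space P. \<bar>u n (f x \<omega>)\<bar> \<le> C"
      using le maps[OF x] by blast
    moreover have "\<forall>v. (\<forall>n. v n \<in> borel_measurable P) \<longrightarrow>
        (\<exists>C. \<forall>n. \<forall>\<omega>\<in>space P. \<bar>v n \<omega>\<bar> \<le> C) \<longrightarrow>
          (\<lambda>\<omega>. B (\<lambda>n. v n \<omega>)) \<in> borel_measurable P \<and>
          (\<integral>\<omega>. B (\<lambda>n. v n \<omega>) \<partial>P) = B (\<lambda>n. \<integral>\<omega>. v n \<omega> \<partial>P)"
      using B unfolding medial_limits_def mem_Collect_eq by (rule conjunct2)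
    ultimately show ?thesis
      using meas by (elim allE[of _ "\<lambda>n \<omega>. u n (f x \<omega>)"]) (elim impE conjE; simp)
  qed
  also have "\<dots> = B (\<lambda>n. u (Suc n) x)"
    by (simp only: step)
  also have "\<dots> = B (\<lambda>n. u n x)"
  proof -
    have "(\<lambda>n. u n x) \<in> bounded_seqs"
      using le[OF x] by (auto simp: bounded_seqs_def bounded_iff)
    moreover have "\<forall>v\<in>bounded_seqs. B (\<lambda>n. v (Suc n)) = B v"
      using B unfolding medial_limits_def banach_limits_def mem_Collect_eq
      by - (elim conjE, assumption)
    ultimately show ?thesis
      by (rule bspec[rotated])
  qed
  also have "\<dots> = limit_fn P f B h x"
    using x by (simp add: limit_fn_def u_def)
  finally show ?thesis by simp
qed

theorem theorem3p2:
  fixes P :: "'w measure"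
    and f :: "real \<Rightarrow> 'w \<Rightarrow> real"
    and S :: "(real \<Rightarrow> real) set"
    and a b :: real
  assumes "prob_space P"
    and "\<And>x \<omega>. x \<in> {0..1} \<Longrightarrow> \<omega> \<in> space P \<Longrightarrow> f x \<omega> \<in> {0..1}"
    and "\<And>\<omega>. \<omega> \<in> space P \<Longrightarrow> f 0 \<omega> = 0"
    and "\<And>\<omega>. \<omega> \<in> space P \<Longrightarrow> f 1 \<omega> = 1"
    and "linear_subspace_of S (measurable_fns P f)"
    and "transfer_op P f ` S \<subseteq> S"
  shows "\<forall>B\<in>medial_limits P.
           sol_E0 P f S a b \<subseteq> {limit_fn P f B h | h. h \<in> with_boundary S a b} \<and>
           (closed_under P f (with_boundary S a b) B \<longrightarrow>
              sol_E0 P f S a b = {limit_fn P f B h | h. h \<in> with_boundary S a b})"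
proof (intro ballI)
  fix B assume B: "B \<in> medial_limits P"
  then have banach: "B \<in> banach_limits"
    by (simp add: medial_limits_def)
  have sub: "S \<subseteq> measurable_fns P f"
    using assms(5) by (simp add: linear_subspace_of_def)
  have incl: "sol_E0 P f S a b \<subseteq> {limit_fn P f B h | h. h \<in> with_boundary S a b}"
  proof
    fix \<Phi> assume "\<Phi> \<in> sol_E0 P f S a b"
    then have mem: "\<Phi> \<in> with_boundary S a b" and fixed_point: "transfer_op P f \<Phi> = \<Phi>"
      using sol_E0_iff_fixed_point[OF sub] by auto
    have "\<Phi> \<in> extensional {0..1}"
      using mem sub by (auto simp: with_boundary_def measurable_fns_def bounded_fns_def)
    then have "\<Phi> = limit_fn P f B \<Phi>"
      using limit_fn_fixed_point[OF banach _ fixed_point] by simp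
    then show "\<Phi> \<in> {limit_fn P f B h | h. h \<in> with_boundary S a b}"
      using mem by blast
  qed
  have "limit_fn P f B h \<in> sol_E0 P f S a b"
    if closed: "closed_under P f (with_boundary S a b) B" and h: "h \<in> with_boundary S a b" for h
  proof -
    have "h \<in> S"
      using h by (simp add: with_boundary_def)
    moreover have "limit_fn P f B h \<in> with_boundary S a b"
      using closed h by (simp add: closed_under_def)
    ultimately show ?thesis
      unfolding sol_E0_def using limit_fn_solves[OF assms(1,2) sub assms(6) B] by blast
  qed
  with incl show "sol_E0 P f S a b \<subseteq> {limit_fn P f B h | h. h \<in> with_boundary S a b} \<and>
      (closed_under P f (with_boundary S a b) B \<longrightarrow>
         sol_E0 P f S a b = {limit_fn P f B h | h. h \<in> with_boundary S a b})"
    by blast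
qed

end
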